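(* Let $\chi$ be a primitive nonprincipal Dirichlet character with conductor $q$, and let $\Phi=\{j\mid 1\le j\le q-1,\ \gcd(j,q)=1\}$. Then for all integers $n\ge 1$, $$L_n(\chi)=\frac{1}{q^n}\sum_{(k_j)_{j\in\Phi}}\ \prod_{j\in\Phi}\frac{\chi(j)^{k_j}}{k_j!}\sum_{k=1}^{k_j}(-1)^kB_{k_j,k}\left(\psi(\tfrac jq),\psi_1(\tfrac jq),\ldots,\psi_{k_j-k}(\tfrac jq)\right),$$ where the outer sum is over all families $(k_j)_{j\in\Phi}$ of nonnegative integers with $\sum_{j\in\Phi}k_j=n$, and where for $k_j=0$ the factor of the product belonging to $j$ is understood to be $1$.
   Context: $L_n(\chi):=\sum_{1\le k_1<\dots<k_n}\frac{\chi(k_1)}{k_1}\cdots\frac{\chi(k_n)}{k_n}$, understood as the limit as $N\to\infty$ of the sums over $1\le k_1<\dots<k_n\le N$. $\psi(y)=\Gamma'(y)/\Gamma(y)$ is the digamma function, $\psi_0=\psi$, and $\psi_j=\psi^{(j)}$ is its $j$th derivative for $j\ge1$. For $1\le k\le n$, the partial exponential Bell polynomial is $$B_{n,k}(x_1,\ldots,x_{n-k+1})=\sum\frac{n!}{j_1!\cdots j_{n-k+1}!}\left(\frac{x_1}{1!}\right)^{j_1}\cdots\left(\frac{x_{n-k+1}}{(n-k+1)!}\right)^{j_{n-k+1}},$$ summed over all nonnegative integers $j_1,\ldots,j_{n-k+1}$ with $j_1+j_2+\dots+j_{n-k+1}=k$ and $j_1+2j_2+\dots+(n-k+1)j_{n-k+1}=n$.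 *)

theory Defs
  imports "HOL-Analysis.Analysis"
begin

definition dirichlet_character :: "nat \<Rightarrow> (int \<Rightarrow> complex) \<Rightarrow> bool" where
  "dirichlet_character q chi \<longleftrightarrow>
     q > 0 \<and>
     (\<forall>a b. chi (a * b) = chi a * chi b) \<and>
     (\<forall>a. chi (a + int q) = chi a) \<and>
     (\<forall>a. chi a \<noteq> 0 \<longleftrightarrow> coprime a (int q))"

definition principal_character :: "nat \<Rightarrow> (int \<Rightarrow> complex) \<Rightarrow> bool" where
  "principal_character q chi \<longleftrightarrow>
     dirichlet_character q chi \<and> (\<forall>a. coprime a (int q) \<longrightarrow> chi a = 1)"

text \<open>The least modulus of a character that induces \<open>chi\<close>.\<close>

definition conductor :: "nat \<Rightarrow> (int \<Rightarrow> complex) \<Rightarrow> nat" where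
  "conductor q chi =
     (LEAST d. d dvd q \<and>
        (\<exists>chi'. dirichlet_character d chi' \<and> (\<forall>a. coprime a (int q) \<longrightarrow> chi a = chi' a)))"

definition primitive_character :: "nat \<Rightarrow> (int \<Rightarrow> complex) \<Rightarrow> bool" where
  "primitive_character q chi \<longleftrightarrow> dirichlet_character q chi \<and> conductor q chi = q"

text \<open>The tuples \<open>1 \<le> k\<^sub>1 < \<dots> < k\<^sub>n \<le> N\<close> are strictly increasing lists of length \<open>n\<close>.\<close>

definition multiple_L_partial :: "(int \<Rightarrow> complex) \<Rightarrow> nat \<Rightarrow> nat \<Rightarrow> complex" where
  "multiple_L_partial chi n N =
     (\<Sum>ks \<in> {ks :: nat list. length ks = n \<and> sorted_wrt (<) ks \<and> set ks \<subseteq> {1..N}}.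
        \<Prod>i<n. chi (int (ks ! i)) / of_nat (ks ! i))"

definition multiple_L :: "nat \<Rightarrow> (int \<Rightarrow> complex) \<Rightarrow> complex" where
  "multiple_L n chi = lim (\<lambda>N. multiple_L_partial chi n N)"

text \<open>
  Meaningful for \<open>1 \<le> k \<le> n\<close>. The variables \<open>x\<^sub>1, \<dots>, x\<^bsub>n-k+1\<^esub>\<close> are the values
  at \<open>1, \<dots>, n - k + 1\<close> of a function \<open>x\<close>.
\<close>

definition partial_Bell :: "nat \<Rightarrow> nat \<Rightarrow> (nat \<Rightarrow> complex) \<Rightarrow> complex" where
  "partial_Bell n k x =
     (\<Sum>j \<in> {j \<in> {1..n - k + 1} \<rightarrow>\<^sub>E (UNIV :: nat set).
              (\<Sum>i = 1..n - k + 1. j i) = k \<and> (\<Sum>i = 1..n - k + 1. i * j i) = n}.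
        fact n / (\<Prod>i = 1..n - k + 1. fact (j i)) *
        (\<Prod>i = 1..n - k + 1. (x i / fact i) ^ j i))"

definition Phi :: "nat \<Rightarrow> nat set" where
  "Phi q = {j. 1 \<le> j \<and> j \<le> q - 1 \<and> gcd j q = 1}"

end

theory Submission imports Defs "HOL-Number_Theory.Cong" begin

text \<open>
  Up to \<open>N\<close>, the sums \<open>L\<^sub>n\<close> are the coefficients of \<open>\<Prod>k\<le>N. (1 + chi k X / k)\<close>. For \<open>N = q M\<close> this product
  splits over the residues \<open>j\<close> into factors \<open>\<Prod>m<M. (1 + w X / (y + m))\<close> with \<open>y = j / q\<close> and
  \<open>w = chi j / q\<close>. As \<open>chi\<close> sums to zero over the residues, each factor may be multiplied by
  \<open>exp (- w ln M X)\<close> without changing the product. The logarithmic derivative of the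
  renormalized factor then converges coefficientwise to \<open>- \<Sum>i. w\<^bsup>i+1\<^esup> \<psi>\<^sub>i(y) X\<^sup>i / i!\<close>, by the limit
  formulas for the polygamma functions. A power series is determined recursively by its
  constant term and its logarithmic derivative, so the factor itself converges coefficientwise
  to \<open>exp (- \<Sum>i\<ge>1. w\<^sup>i \<psi>\<^bsub>i-1\<^esub>(y) X\<^sup>i / i!)\<close>, whose coefficients are alternating sums of Bell polynomials.
  Passing from \<open>q M\<close> to general \<open>N\<close> is an induction on \<open>n\<close>, since consecutive partial sums differ
  by \<open>chi (N + 1) / (N + 1)\<close> times a partial sum for \<open>n - 1\<close>.
\<close>

section \<open>Coefficients of finite products of power series\<close>

text \<open>Splitting a family by its value \<open>i\<close> at \<open>a\<close> is the induction
  step both for finiteness and for iterating the Cauchy product.\<close>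

lemma PiE_sum_insert_eq:
  fixes n :: nat
  assumes "finite A" "a \<notin> A"
  shows "{k \<in> insert a A \<rightarrow>\<^sub>E UNIV. (\<Sum>j\<in>insert a A. k j) = n} =
    (\<lambda>(i, k). k(a := i)) ` (SIGMA i:{0..n}. {k \<in> A \<rightarrow>\<^sub>E UNIV. (\<Sum>j\<in>A. k j) = n - i})"
    (is "?L = ?f ` ?R")
proof
  show "?f ` ?R \<subseteq> ?L"
  proof
    fix k assume "k \<in> ?f ` ?R"
    then obtain i k' where k: "k = k'(a := i)" "i \<le> n" "k' \<in> A \<rightarrow>\<^sub>E UNIV" "(\<Sum>j\<in>A. k' j) = n - i"
      by auto
    have "(\<Sum>j\<in>A. k j) = (\<Sum>j\<in>A. k' j)"
      using assms k(1) by (intro sum.cong) auto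
    then show "k \<in> ?L" using assms k by (auto simp: PiE_def extensional_def)
  qed
  show "?L \<subseteq> ?f ` ?R"
  proof
    fix k assume k: "k \<in> ?L"
    \<comment> \<open>Extensional functions on \<open>A\<close> are \<open>undefined\<close> at
      \<open>a\<close>, so \<open>k\<close> is reset there to land in the function space over
      \<open>A\<close>.\<close>
    define k' where "k' = k(a := undefined)"
    have "(\<Sum>j\<in>A. k' j) = (\<Sum>j\<in>A. k j)"
      using assms unfolding k'_def by (intro sum.cong) auto
    then have "(k a, k') \<in> ?R"
      using k assms by (auto simp: k'_def PiE_def extensional_def)
    moreover have "k = ?f (k a, k')" by (simp add: k'_def)
    ultimately show "k \<in> ?f ` ?R" by (intro image_eqI)
  qed
qed

lemma finite_PiE_sum_eq:
  fixes n :: nat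
  assumes "finite A"
  shows "finite {k \<in> A \<rightarrow>\<^sub>E UNIV. (\<Sum>j\<in>A. k j) = n}"
  using assms
proof (induction A arbitrary: n rule: finite_induct)
  case empty
  then show ?case by simp
next
  case (insert a A)
  show ?case
    unfolding PiE_sum_insert_eq[OF insert.hyps] using insert.IH by auto
qed

text \<open>The Cauchy product, iterated over \<open>A\<close>: the factor at \<open>j\<close>
  contributes degree \<open>k j\<close>. For \<open>A = Phi q\<close> this becomes the outer sum of
  the theorem.\<close>

lemma fps_nth_prod_PiE:
  fixes f :: "'b \<Rightarrow> 'a::comm_semiring_1 fps"
  assumes "finite A"
  shows "fps_nth (\<Prod>j\<in>A. f j) n =
    (\<Sum>k \<in> {k \<in> A \<rightarrow>\<^sub>E UNIV. (\<Sum>j\<in>A. k j) = n}. \<Prod>j\<in>A. fps_nth (f j) (k j))"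
  using assms
proof (induction A arbitrary: n rule: finite_induct)
  case empty
  have "{k \<in> {} \<rightarrow>\<^sub>E UNIV. (\<Sum>j\<in>{}. k j) = n} = (if n = 0 then {\<lambda>_. undefined} else {})"
    by auto
  then show ?case by simp
next
  case (insert a A)
  let ?S = "\<lambda>n. {k \<in> A \<rightarrow>\<^sub>E UNIV. (\<Sum>j\<in>A. k j) = n}"
  have inj: "inj_on (\<lambda>(i, k). k(a := i)) (SIGMA i:{0..n}. ?S (n - i))"
  proof (rule inj_onI, clarify)
    fix i k i' k'
    assume k: "k \<in> A \<rightarrow>\<^sub>E UNIV" "k' \<in> A \<rightarrow>\<^sub>E UNIV" and eq: "k(a := i) = k'(a := i')"
    have "k x = k' x" for x
    proof (cases "x = a")
      case True
      then show ?thesis using k insert.hyps by (auto simp: PiE_def extensional_def)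
    next
      case False
      then show ?thesis using fun_cong[OF eq, of x] by simp
    qed
    then show "i = i' \<and> k = k'" using fun_cong[OF eq, of a] by auto
  qed
  have "fps_nth (\<Prod>j\<in>insert a A. f j) n =
    (\<Sum>i=0..n. \<Sum>k\<in>?S (n - i). fps_nth (f a) i * (\<Prod>j\<in>A. fps_nth (f j) (k j)))"
    using insert by (simp add: fps_mult_nth sum_distrib_left)
  also have "\<dots> = (\<Sum>(i, k)\<in>(SIGMA i:{0..n}. ?S (n - i)).
      fps_nth (f a) i * (\<Prod>j\<in>A. fps_nth (f j) (k j)))"
    using finite_PiE_sum_eq[OF insert.hyps(1)] by (subst sum.Sigma) auto
  also have "\<dots> = (\<Sum>(i, k)\<in>(SIGMA i:{0..n}. ?S (n - i)).
      \<Prod>j\<in>insert a A. fps_nth (f j) ((k(a := i)) j))"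
  proof (intro sum.cong refl, clarify)
    fix i k
    have "(\<Prod>j\<in>A. fps_nth (f j) (k j)) = (\<Prod>j\<in>A. fps_nth (f j) ((k(a := i)) j))"
      using insert.hyps by (intro prod.cong) auto
    then show "fps_nth (f a) i * (\<Prod>j\<in>A. fps_nth (f j) (k j)) =
      (\<Prod>j\<in>insert a A. fps_nth (f j) ((k(a := i)) j))"
      using insert.hyps by simp
  qed
  also have "\<dots> = (\<Sum>k \<in> {k \<in> insert a A \<rightarrow>\<^sub>E UNIV. (\<Sum>j\<in>insert a A. k j) = n}.
      \<Prod>j\<in>insert a A. fps_nth (f j) (k j))"
    unfolding PiE_sum_insert_eq[OF insert.hyps]
    by (subst sum.reindex[OF inj]) (simp add: case_prod_unfold o_def)
  finally show ?case .
qed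

section \<open>Power series determined by their logarithmic derivative\<close>

text \<open>The product rule makes logarithmic derivatives add up. The relation f' = f s stands for
  the quotient f' / f, so that nothing has to be inverted.\<close>

lemma fps_deriv_prod_logderiv:
  fixes f s :: "'b \<Rightarrow> 'a::comm_ring_1 fps"
  assumes "finite A" "\<And>i. i \<in> A \<Longrightarrow> fps_deriv (f i) = f i * s i"
  shows "fps_deriv (\<Prod>i\<in>A. f i) = (\<Prod>i\<in>A. f i) * (\<Sum>i\<in>A. s i)"
  using assms by (induction A rule: finite_induct) (auto simp: algebra_simps)

text \<open>Comparing coefficients in f' = f s expresses (k + 1) f_(k+1) as the sum of the f_i
  s_(k-i). So the coefficient at \<open>n\<close> is a polynomial in the constant term and the first
  \<open>n\<close> coefficients of s, and limits pass through.\<close>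

lemma fps_logderiv_tendsto:
  fixes G S :: "nat \<Rightarrow> complex fps"
  assumes G: "\<And>M. fps_deriv (G M) = G M * S M"
    and g: "fps_deriv g = g * t"
    and zero: "\<And>M. fps_nth (G M) 0 = fps_nth g 0"
    and lim: "\<And>i. i < n \<Longrightarrow> (\<lambda>M. fps_nth (S M) i) \<longlonglongrightarrow> fps_nth t i"
  shows "(\<lambda>M. fps_nth (G M) n) \<longlonglongrightarrow> fps_nth g n"
proof -
  have rec: "fps_nth f (Suc k) = (\<Sum>i=0..k. fps_nth f i * fps_nth s (k - i)) / of_nat (Suc k)"
    if "fps_deriv f = f * s" for f s :: "complex fps" and k
  proof -
    have "of_nat (Suc k) * fps_nth f (Suc k) = fps_nth (f * s) k"
      unfolding that[symmetric] by simp
    then show ?thesis by (simp add: fps_mult_nth field_simps del: of_nat_Suc)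
  qed
  have "k \<le> n \<Longrightarrow> (\<lambda>M. fps_nth (G M) k) \<longlonglongrightarrow> fps_nth g k" for k
  proof (induction k rule: less_induct)
    case (less k)
    show ?case
    proof (cases k)
      case 0
      then show ?thesis by (simp add: zero)
    next
      case (Suc m)
      show ?thesis
        unfolding Suc rec[OF G] rec[OF g] using less Suc
        by (intro tendsto_divide tendsto_sum tendsto_mult lim tendsto_const) (auto simp del: of_nat_Suc)
    qed
  qed
  then show ?thesis by simp
qed

lemma fps_nth_0_prod: "fps_nth (\<Prod>i\<in>A. f i) 0 = (\<Prod>i\<in>A. fps_nth (f i) 0)"
  for f :: "'b \<Rightarrow> 'a::comm_ring_1 fps"
  by (induction A rule: infinite_finite_induct) auto

section \<open>Exponentials of powers of X and Bell polynomials\<close>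

lemma fps_nth_compose_X_power:
  fixes f :: "'a::comm_ring_1 fps"
  assumes "d > 0"
  shows "fps_nth (f oo fps_X ^ d) n = (if d dvd n then fps_nth f (n div d) else 0)"
proof -
  have "fps_nth (f oo fps_X ^ d) n = (\<Sum>i=0..n. if n = d * i then fps_nth f i else 0)"
    unfolding fps_compose_nth by (intro sum.cong) (auto simp flip: power_mult)
  also have "\<dots> = (\<Sum>i=0..n. if i = n div d then (if d dvd n then fps_nth f i else 0) else 0)"
    using assms by (intro sum.cong) auto
  also have "\<dots> = (if d dvd n then fps_nth f (n div d) else 0)"
    by (simp add: sum.delta)
  finally show ?thesis .
qed

text \<open>Chain rule for exp(a X^i). The logarithmic derivative is a monomial, so in a product of
  such factors each one accounts for exactly one coefficient.\<close>

lemma fps_deriv_exp_compose_X_power: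
  fixes a :: "'a::field_char_0"
  assumes "i > 0"
  shows "fps_deriv (fps_exp a oo fps_X ^ i) =
    (fps_exp a oo fps_X ^ i) * (fps_const (of_nat i * a) * fps_X ^ (i - 1))"
proof -
  have "fps_deriv (fps_exp a oo fps_X ^ i) =
      (fps_const a * fps_exp a oo fps_X ^ i) * fps_deriv (fps_X ^ i)"
    using assms by (subst fps_compose_deriv) auto
  also have "fps_const a * fps_exp a oo fps_X ^ i = fps_const a * (fps_exp a oo fps_X ^ i)"
    using assms by (subst fps_compose_mult_distrib) auto
  also have "fps_deriv (fps_X ^ i :: 'a fps) = fps_const (of_nat i) * fps_X ^ (i - 1)"
    by (simp add: fps_deriv_power)
  finally show ?thesis by (simp flip: fps_const_mult add: mult_ac)
qed

lemma finite_PiE_weighted_sum_eq: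
  fixes n :: nat
  shows "finite {j \<in> {1..L} \<rightarrow>\<^sub>E (UNIV :: nat set). (\<Sum>i=1..L. i * j i) = n}"
proof (rule finite_subset)
  show "{j \<in> {1..L} \<rightarrow>\<^sub>E (UNIV :: nat set). (\<Sum>i=1..L. i * j i) = n} \<subseteq> {1..L} \<rightarrow>\<^sub>E {..n}"
  proof
    fix j assume j: "j \<in> {j \<in> {1..L} \<rightarrow>\<^sub>E (UNIV :: nat set). (\<Sum>i=1..L. i * j i) = n}"
    have "j i \<le> n" if i: "i \<in> {1..L}" for i
    proof -
      have "j i \<le> i * j i" using i by simp
      also have "\<dots> \<le> (\<Sum>i=1..L. i * j i)" using i by (intro member_le_sum) auto
      finally show ?thesis using j by simp
    qed
    then show "j \<in> {1..L} \<rightarrow>\<^sub>E {..n}" using j by (auto simp: PiE_def)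
  qed
qed (auto intro: finite_PiE)

text \<open>A part of size \<open>i\<close> together with \<open>k - 1\<close> further parts has total size at least \<open>i + k - 1\<close>,
  so only the variables \<open>x\<^sub>1, \<dots>, x\<^bsub>n-k+1\<^esub>\<close> can occur.\<close>

lemma partial_Bell_eq_sum_full:
  assumes "1 \<le> k" "k \<le> n"
  shows "partial_Bell n k x =
    fact n * (\<Sum>j \<in> {j \<in> {1..n} \<rightarrow>\<^sub>E (UNIV :: nat set). (\<Sum>i=1..n. i * j i) = n \<and> (\<Sum>i=1..n. j i) = k}.
        \<Prod>i=1..n. (x i / fact i) ^ j i / fact (j i))"
proof -
  define L where "L = n - k + 1"
  have L: "L \<le> n" using assms by (simp add: L_def)
  let ?A = "{j \<in> {1..L} \<rightarrow>\<^sub>E (UNIV :: nat set). (\<Sum>i=1..L. j i) = k \<and> (\<Sum>i=1..L. i * j i) = n}"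
  let ?B = "{j \<in> {1..n} \<rightarrow>\<^sub>E (UNIV :: nat set). (\<Sum>i=1..n. i * j i) = n \<and> (\<Sum>i=1..n. j i) = k}"
  \<comment> \<open>Padding by zeros identifies the families on \<open>{1..L}\<close> with those on
    \<open>{1..n}\<close> that vanish beyond \<open>L\<close>.\<close>
  define ext :: "(nat \<Rightarrow> nat) \<Rightarrow> nat \<Rightarrow> nat"
    where "ext j = (\<lambda>i\<in>{1..n}. if i \<le> L then j i else 0)" for j
  have ext_sum: "(\<Sum>i=1..n. h i (ext j i)) = (\<Sum>i=1..L. h i (j i))"
    if "\<And>i. h i 0 = 0" for h :: "nat \<Rightarrow> nat \<Rightarrow> nat" and j
    using L that by (intro sum.mono_neutral_cong_right) (auto simp: ext_def)
  have zero: "j i = 0" if j: "j \<in> ?B" and i: "i \<in> {1..n}" "i > L" for j i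
  proof (rule ccontr)
    assume "j i \<noteq> 0"
    have "n = (\<Sum>i'=1..n. i' * j i')" using j by simp
    also have "\<dots> = i * j i + (\<Sum>i'\<in>{1..n} - {i}. i' * j i')"
      using i by (subst sum.remove[of _ i]) auto
    also have "\<dots> \<ge> i * j i + (\<Sum>i'\<in>{1..n} - {i}. j i')"
      by (intro add_left_mono sum_mono) auto
    finally have 1: "n \<ge> i * j i + (\<Sum>i'\<in>{1..n} - {i}. j i')" .
    have 2: "k = j i + (\<Sum>i'\<in>{1..n} - {i}. j i')"
      using j i by (subst sum.remove[of _ i, symmetric]) auto
    \<comment> \<open>As \<open>i \<ge> 1\<close>, \<open>i * Suc d \<ge> i + d\<close>. With
      \<open>1\<close> and \<open>2\<close> this gives n \<ge> i + k - 1, contradicting i > n - k +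
      1.\<close>
    obtain d where d: "j i = Suc d" using \<open>j i \<noteq> 0\<close> not0_implies_Suc by blast
    have "i + d \<le> i * j i" using i d by simp
    then show False using 1 2 i d unfolding L_def by linarith
  qed
  have bij: "bij_betw ext ?A ?B"
  proof (rule bij_betw_byWitness[where f' = "\<lambda>j. restrict j {1..L}"])
    show "\<forall>j\<in>?A. restrict (ext j) {1..L} = j"
      using L by (auto simp: ext_def fun_eq_iff PiE_def extensional_def restrict_def)
    show "\<forall>j\<in>?B. ext (restrict j {1..L}) = j"
      using zero L by (fastforce simp: ext_def fun_eq_iff PiE_def extensional_def restrict_def)
    show "ext ` ?A \<subseteq> ?B"
      using ext_sum[of "\<lambda>i v. v"] ext_sum[of "\<lambda>i v. i * v"] by (auto simp: ext_def)
    show "(\<lambda>j. restrict j {1..L}) ` ?B \<subseteq> ?A"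
    proof clarify
      fix j assume j: "j \<in> {1..n} \<rightarrow>\<^sub>E (UNIV :: nat set)" "(\<Sum>i=1..n. i * j i) = n" "k = (\<Sum>i=1..n. j i)"
      have z: "j i = 0" if "i \<in> {1..n}" "i > L" for i using zero[of j i] j that by auto
      have "(\<Sum>i=1..L. restrict j {1..L} i) = (\<Sum>i=1..n. j i)"
        using L z by (intro sum.mono_neutral_cong_left) auto
      moreover have "(\<Sum>i=1..L. i * restrict j {1..L} i) = (\<Sum>i=1..n. i * j i)"
        using L z by (intro sum.mono_neutral_cong_left) auto
      ultimately show "restrict j {1..L} \<in> {1..L} \<rightarrow>\<^sub>E UNIV \<and>
          (\<Sum>i=1..L. restrict j {1..L} i) = (\<Sum>i=1..n. j i) \<and>
          (\<Sum>i=1..L. i * restrict j {1..L} i) = n"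
        using j by auto
    qed
  qed
  have "(\<Sum>j\<in>?B. \<Prod>i=1..n. (x i / fact i) ^ j i / fact (j i)) =
      (\<Sum>j\<in>?A. \<Prod>i=1..n. (x i / fact i) ^ ext j i / fact (ext j i))"
    by (rule sum.reindex_bij_betw[OF bij, symmetric])
  also have "\<dots> = (\<Sum>j\<in>?A. \<Prod>i=1..L. (x i / fact i) ^ j i / fact (j i))"
    using L by (intro sum.cong refl prod.mono_neutral_cong_right) (auto simp: ext_def)
  finally show ?thesis
    unfolding partial_Bell_def L_def[symmetric]
    by (simp add: sum_distrib_left prod_dividef)
qed

text \<open>After expansion, a term is given by multiplicities \<open>j i\<close> of parts of size
  \<open>i\<close> with total size \<open>n\<close>. The powers of \<open>w\<close> collect to
  \<open>w ^ n\<close>, the signs to -1 to the number of parts, and grouping by this number produces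
  the Bell polynomials.\<close>

lemma fps_nth_prod_exp_eq_partial_Bell:
  fixes x :: "nat \<Rightarrow> complex"
  assumes "n > 0"
  shows "fps_nth (\<Prod>i=1..n. fps_exp (- (w ^ i * x i / fact i)) oo fps_X ^ i) n =
    w ^ n / fact n * (\<Sum>m=1..n. (-1) ^ m * partial_Bell n m x)"
proof -
  let ?a = "\<lambda>i. - (w ^ i * x i / fact i)"
  let ?K = "{k \<in> {1..n} \<rightarrow>\<^sub>E UNIV. (\<Sum>i=1..n. k i) = n}"
  let ?J = "{j \<in> {1..n} \<rightarrow>\<^sub>E (UNIV :: nat set). (\<Sum>i=1..n. i * j i) = n}"
  let ?t = "\<lambda>j. \<Prod>i=1..n. (x i / fact i) ^ j i / fact (j i)"
  have nth: "fps_nth (fps_exp (?a i) oo fps_X ^ i) k =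
      (if i dvd k then ?a i ^ (k div i) / fact (k div i) else 0)" if "i \<in> {1..n}" for i k
    using that by (simp add: fps_nth_compose_X_power)
  \<comment> \<open>The factor at \<open>i\<close> is a series in X^i, so its degree
    \<open>i * j i\<close> encodes the multiplicity \<open>j i\<close>; degrees not divisible by
    \<open>i\<close> contribute zero.\<close>
  have bij: "bij_betw (\<lambda>j. \<lambda>i\<in>{1..n}. i * j i) ?J {k \<in> ?K. \<forall>i\<in>{1..n}. i dvd k i}"
    by (rule bij_betw_byWitness[where f' = "\<lambda>k. \<lambda>i\<in>{1..n}. k i div i"])
      (auto simp: fun_eq_iff PiE_def extensional_def restrict_def)
  have "fps_nth (\<Prod>i=1..n. fps_exp (?a i) oo fps_X ^ i) n =
      (\<Sum>k\<in>?K. \<Prod>i=1..n. if i dvd k i then ?a i ^ (k i div i) / fact (k i div i) else 0)"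
    by (subst fps_nth_prod_PiE) (auto intro!: sum.cong prod.cong simp: nth)
  also have "\<dots> = (\<Sum>k\<in>{k \<in> ?K. \<forall>i\<in>{1..n}. i dvd k i}. \<Prod>i=1..n. ?a i ^ (k i div i) / fact (k i div i))"
    using finite_PiE_sum_eq[of "{1..n}" n]
    by (intro sum.mono_neutral_cong_right) (auto intro!: prod.cong)
  also have "\<dots> = (\<Sum>j\<in>?J. \<Prod>i=1..n. ?a i ^ ((\<lambda>i\<in>{1..n}. i * j i) i div i) / fact ((\<lambda>i\<in>{1..n}. i * j i) i div i))"
    by (rule sum.reindex_bij_betw[OF bij, symmetric])
  also have "\<dots> = (\<Sum>j\<in>?J. \<Prod>i=1..n. ?a i ^ j i / fact (j i))"
    by (intro sum.cong prod.cong refl) auto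
  also have "\<dots> = (\<Sum>j\<in>?J. w ^ n * ((-1) ^ (\<Sum>i=1..n. j i) * ?t j))"
  proof (intro sum.cong refl)
    fix j assume j: "j \<in> ?J"
    have "(\<Prod>i=1..n. ?a i ^ j i / fact (j i)) =
        (\<Prod>i=1..n. w ^ (i * j i) * ((-1) ^ j i * ((x i / fact i) ^ j i / fact (j i))))"
    proof (intro prod.cong refl)
      fix i
      have "?a i = w ^ i * (- 1 * (x i / fact i))" by simp
      then have "?a i ^ j i = w ^ (i * j i) * ((-1) ^ j i * (x i / fact i) ^ j i)"
        by (simp only: power_mult_distrib power_mult)
      then show "?a i ^ j i / fact (j i) =
          w ^ (i * j i) * ((-1) ^ j i * ((x i / fact i) ^ j i / fact (j i)))"
        by (simp only: times_divide_eq_right)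
    qed
    also have "\<dots> = w ^ (\<Sum>i=1..n. i * j i) * ((-1) ^ (\<Sum>i=1..n. j i) * ?t j)"
      by (simp only: prod.distrib power_sum)
    finally show "(\<Prod>i=1..n. ?a i ^ j i / fact (j i)) = w ^ n * ((-1) ^ (\<Sum>i=1..n. j i) * ?t j)"
      using j by simp
  qed
  also have "\<dots> = w ^ n * (\<Sum>j\<in>?J. (-1) ^ (\<Sum>i=1..n. j i) * ?t j)"
    by (simp add: sum_distrib_left)
  also have "(\<Sum>j\<in>?J. (-1) ^ (\<Sum>i=1..n. j i) * ?t j) =
      (\<Sum>m=1..n. \<Sum>j\<in>{j \<in> ?J. (\<Sum>i=1..n. j i) = m}. (-1) ^ (\<Sum>i=1..n. j i) * ?t j)"
  proof (rule sum.group[symmetric, OF finite_PiE_weighted_sum_eq])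
    show "(\<lambda>j. \<Sum>i=1..n. j i) ` ?J \<subseteq> {1..n}"
    proof clarify
      fix j assume j: "(\<Sum>i=1..n. i * j i) = n"
      have "(\<Sum>i=1..n. j i) \<le> (\<Sum>i=1..n. i * j i)" by (intro sum_mono) auto
      \<comment> \<open>As \<open>n > 0\<close>, at least one part occurs, so the grouping may start
        at \<open>m = 1\<close>.\<close>
      moreover have "(\<Sum>i=1..n. j i) \<noteq> 0"
      proof
        assume "(\<Sum>i=1..n. j i) = 0"
        then have "(\<Sum>i=1..n. i * j i) = 0" by simp
        then show False using j assms by simp
      qed
      ultimately show "(\<Sum>i=1..n. j i) \<in> {1..n}" using j unfolding atLeastAtMost_iff by linarith
    qed
  qed simp
  also have "\<dots> = (\<Sum>m=1..n. (-1) ^ m * (partial_Bell n m x / fact n))"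
  proof (intro sum.cong refl)
    fix m assume m: "m \<in> {1..n}"
    have "{j \<in> ?J. (\<Sum>i=1..n. j i) = m} =
        {j \<in> {1..n} \<rightarrow>\<^sub>E (UNIV :: nat set). (\<Sum>i=1..n. i * j i) = n \<and> (\<Sum>i=1..n. j i) = m}"
      by auto
    then have Bell: "(\<Sum>j\<in>{j \<in> ?J. (\<Sum>i=1..n. j i) = m}. ?t j) = partial_Bell n m x / fact n"
      using m by (simp add: partial_Bell_eq_sum_full)
    have "(\<Sum>j\<in>{j \<in> ?J. (\<Sum>i=1..n. j i) = m}. (-1) ^ (\<Sum>i=1..n. j i) * ?t j) =
        (\<Sum>j\<in>{j \<in> ?J. (\<Sum>i=1..n. j i) = m}. (-1) ^ m * ?t j)"
      by (intro sum.cong refl) auto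
    also have "\<dots> = (-1) ^ m * (partial_Bell n m x / fact n)"
      by (simp only: Bell flip: sum_distrib_left)
    finally show "(\<Sum>j\<in>{j \<in> ?J. (\<Sum>i=1..n. j i) = m}. (-1) ^ (\<Sum>i=1..n. j i) * ?t j) =
        (-1) ^ m * (partial_Bell n m x / fact n)" .
  qed
  finally show ?thesis by (simp add: sum_distrib_left sum_divide_distrib)
qed

section \<open>The renormalized product over one residue class\<close>

text \<open>The exponential factor changes only coefficient 0 of the logarithmic derivative, where
  it removes the logarithmic divergence; the other coefficients converge by themselves.\<close>

lemma fps_nth_renormalized_prod_tendsto:
  fixes w y :: complex
  assumes "y \<noteq> 0"
  shows "(\<lambda>M. fps_nth ((\<Prod>m<M. 1 + fps_const (w / (y + of_nat m)) * fps_X) *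
      fps_exp (- (w * of_real (ln (real M))))) n) \<longlonglongrightarrow>
    (if n = 0 then 1 else w ^ n / fact n *
      (\<Sum>m=1..n. (-1) ^ m * partial_Bell n m (\<lambda>i. Polygamma (i - 1) y)))"
proof -
  let ?c = "\<lambda>m. w / (y + of_nat m)"
  \<comment> \<open>The target product is cut off at \<open>i = n\<close>, since later factors leave
    the coefficient of X^n alone. \<open>?T\<close> and \<open>?S\<close> are the logarithmic
    derivatives of \<open>?E\<close> and \<open>?G\<close>.\<close>
  let ?E = "\<lambda>i. fps_exp (- (w ^ i * Polygamma (i - 1) y / fact i)) oo fps_X ^ i"
  let ?T = "\<lambda>i. fps_const (of_nat i * - (w ^ i * Polygamma (i - 1) y / fact i)) * fps_X ^ (i - 1)"
  let ?G = "\<lambda>M. (\<Prod>m<M. 1 + fps_const (?c m) * fps_X) * fps_exp (- (w * of_real (ln (real M))))"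
  let ?S = "\<lambda>M. (\<Sum>m<M. Abs_fps (\<lambda>i. ?c m * (- ?c m) ^ i)) + fps_const (- (w * of_real (ln (real M))))"
  have "(\<lambda>M. fps_nth (?G M) n) \<longlonglongrightarrow> fps_nth (\<Prod>i=1..n. ?E i) n"
  proof (rule fps_logderiv_tendsto)
    \<comment> \<open>The logarithmic derivative c / (1 + c X), as a geometric series.\<close>
    have lin: "fps_deriv (1 + fps_const c * fps_X) =
        (1 + fps_const c * fps_X) * Abs_fps (\<lambda>i. c * (- c) ^ i)" for c :: complex
    proof (rule fps_ext)
      fix k
      show "fps_nth (fps_deriv (1 + fps_const c * fps_X)) k =
          fps_nth ((1 + fps_const c * fps_X) * Abs_fps (\<lambda>i. c * (- c) ^ i)) k"
        by (cases k) (auto simp: distrib_right mult.assoc)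
    qed
    fix M
    have "fps_deriv (\<Prod>m<M. 1 + fps_const (?c m) * fps_X) =
        (\<Prod>m<M. 1 + fps_const (?c m) * fps_X) * (\<Sum>m<M. Abs_fps (\<lambda>i. ?c m * (- ?c m) ^ i))"
      by (intro fps_deriv_prod_logderiv lin) auto
    then show "fps_deriv (?G M) = ?G M * ?S M"
      by (simp add: algebra_simps)
    show "fps_deriv (\<Prod>i=1..n. ?E i) = (\<Prod>i=1..n. ?E i) * (\<Sum>i=1..n. ?T i)"
      by (intro fps_deriv_prod_logderiv fps_deriv_exp_compose_X_power) auto
    show "fps_nth (?G M) 0 = fps_nth (\<Prod>i=1..n. ?E i) 0"
      by (simp add: fps_nth_0_prod)
  next
    fix i assume i: "i < n"
    \<comment> \<open>Only \<open>l = Suc i\<close> contributes, and l / l! = 1 / i!.\<close>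
    have "fps_nth (\<Sum>i=1..n. ?T i) i =
        (\<Sum>l=1..n. if l = Suc i then of_nat l * - (w ^ l * Polygamma (l - 1) y / fact l) else 0)"
      unfolding fps_sum_nth by (intro sum.cong) auto
    also have "\<dots> = - (w ^ Suc i * Polygamma i y / fact i)"
      using i by (simp add: sum.delta' divide_simps del: of_nat_Suc power_Suc)
    finally have T: "fps_nth (\<Sum>i=1..n. ?T i) i = - (w ^ Suc i * Polygamma i y / fact i)" .
    show "(\<lambda>M. fps_nth (?S M) i) \<longlonglongrightarrow> fps_nth (\<Sum>i=1..n. ?T i) i"
    proof (cases "i = 0")
      \<comment> \<open>Coefficient 0: \<open>ln M\<close> compensates the harmonic growth of the
        sum, and the difference tends to the digamma value.\<close>
      case True
      have "(\<lambda>M. - w * (of_real (ln (real M)) - (\<Sum>m<M. inverse (y + of_nat m)))) \<longlonglongrightarrow> - w * Digamma y"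
        by (intro tendsto_intros Digamma_LIMSEQ assms)
      then show ?thesis unfolding T using True
        by (simp add: fps_sum_nth divide_inverse right_diff_distrib flip: sum_distrib_left)
    next
      \<comment> \<open>The sums are partial sums of the series for the higher polygamma functions.
        The signs (-1)^i and (-1)^(i+1) leave a single minus.\<close>
      case False
      have "(\<lambda>M. \<Sum>m<M. inverse ((y + of_nat m) ^ Suc i)) \<longlonglongrightarrow> (-1) ^ Suc i * Polygamma i y / fact i"
        using Polygamma_LIMSEQ[OF assms, of i] False by (simp add: sums_def)
      then have "(\<lambda>M. (-1) ^ i * w ^ Suc i * (\<Sum>m<M. inverse ((y + of_nat m) ^ Suc i))) \<longlonglongrightarrow>
          (-1) ^ i * w ^ Suc i * ((-1) ^ Suc i * Polygamma i y / fact i)"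
        by (rule tendsto_mult_left)
      also have "(-1) ^ i * w ^ Suc i * ((-1) ^ Suc i * Polygamma i y / fact i) =
          - (w ^ Suc i * Polygamma i y / fact i)"
        by (simp add: mult_ac flip: power_mult_distrib)
      also have "(\<lambda>M. (-1) ^ i * w ^ Suc i * (\<Sum>m<M. inverse ((y + of_nat m) ^ Suc i))) = (\<lambda>M. fps_nth (?S M) i)"
        using False
        by (simp add: fps_sum_nth sum_distrib_left fun_eq_iff divide_inverse power_mult_distrib
            power_inverse power_minus[of "_ * _"] mult_ac)
      finally show ?thesis unfolding T .
    qed
  qed
  then show ?thesis
    using fps_nth_prod_exp_eq_partial_Bell[of n w "\<lambda>i. Polygamma (i - 1) y"] by (cases "n = 0") auto
qed

section \<open>Partial sums as coefficients of a product\<close>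

lemma fps_nth_Suc_mult_linear:
  fixes f :: "'a::comm_ring_1 fps"
  shows "fps_nth (f * (1 + fps_const c * fps_X)) (Suc n) = fps_nth f (Suc n) + c * fps_nth f n"
  by (simp add: distrib_left mult.left_commute[of f])

text \<open>Each factor contributes 1 or its X-term, so degree \<open>n\<close> selects
  \<open>n\<close> distinct indices, that is, one increasing list.\<close>

lemma fps_nth_prod_linear_eq_multiple_L_partial:
  "fps_nth (\<Prod>k=1..N. 1 + fps_const (chi (int k) / of_nat k) * fps_X) n = multiple_L_partial chi n N"
proof (induction N arbitrary: n)
  case 0
  have "{ks :: nat list. length ks = n \<and> sorted_wrt (<) ks \<and> set ks \<subseteq> {1..0}} = (if n = 0 then {[]} else {})"
    by auto
  then show ?case by (simp add: multiple_L_partial_def)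
next
  case (Suc N)
  let ?A = "\<lambda>n N. {ks :: nat list. length ks = n \<and> sorted_wrt (<) ks \<and> set ks \<subseteq> {1..N}}"
  let ?p = "\<lambda>n ks. \<Prod>i<n. chi (int (ks ! i)) / of_nat (ks ! i)"
  have fin: "finite (?A n N)" for n N
    by (rule finite_subset[OF _ finite_lists_length_eq[of "{1..N}" n]]) auto
  show ?case
  proof (cases n)
    case 0
    have "?A 0 N = {[]}" for N by auto
    then show ?thesis using 0 by (simp add: multiple_L_partial_def fps_nth_0_prod)
  next
    case (Suc n')
    \<comment> \<open>In an increasing list with entries up to \<open>Suc N\<close>, only the last
      entry can equal \<open>Suc N\<close>.\<close>
    have split: "?A (Suc n') (Suc N) = ?A (Suc n') N \<union> (\<lambda>ks. ks @ [Suc N]) ` ?A n' N"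
    proof (intro equalityI subsetI)
      fix ks assume ks: "ks \<in> ?A (Suc n') (Suc N)"
      then obtain ks' l where eq: "ks = ks' @ [l]"
        by (cases ks rule: rev_cases) auto
      have "ks' \<in> ?A n' N" if "l = Suc N"
        using ks that unfolding eq by (fastforce simp: sorted_wrt_append)
      moreover have "ks \<in> ?A (Suc n') N" if "l \<noteq> Suc N"
        using ks that unfolding eq by (fastforce simp: sorted_wrt_append)
      ultimately show "ks \<in> ?A (Suc n') N \<union> (\<lambda>ks. ks @ [Suc N]) ` ?A n' N"
        using eq by (cases "l = Suc N") auto
    qed (fastforce simp: sorted_wrt_append)
    have disj: "?A (Suc n') N \<inter> (\<lambda>ks. ks @ [Suc N]) ` ?A n' N = {}"
      by auto
    have "multiple_L_partial chi (Suc n') (Suc N) =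
        multiple_L_partial chi (Suc n') N + (\<Sum>ks\<in>(\<lambda>ks. ks @ [Suc N]) ` ?A n' N. ?p (Suc n') ks)"
      unfolding multiple_L_partial_def split using fin disj by (subst sum.union_disjoint) auto
    also have "(\<Sum>ks\<in>(\<lambda>ks. ks @ [Suc N]) ` ?A n' N. ?p (Suc n') ks) =
        (\<Sum>ks\<in>?A n' N. ?p (Suc n') (ks @ [Suc N]))"
      by (subst sum.reindex) (auto simp: inj_on_def)
    also have "\<dots> = (\<Sum>ks\<in>?A n' N. ?p n' ks * (chi (int (Suc N)) / of_nat (Suc N)))"
      by (intro sum.cong refl) (auto simp: nth_append simp del: of_nat_Suc)
    also have "\<dots> = multiple_L_partial chi n' N * (chi (int (Suc N)) / of_nat (Suc N))"
      by (simp only: multiple_L_partial_def sum_distrib_right)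
    finally show ?thesis
      unfolding Suc
      by (simp add: prod.nat_ivl_Suc' mult.commute[of "1 + _"] fps_nth_Suc_mult_linear
          Suc.IH[unfolded One_nat_def] mult.commute[of "chi _"] del: of_nat_Suc)
  qed
qed

lemma multiple_L_partial_Suc:
  "multiple_L_partial chi (Suc n) (Suc N) =
    multiple_L_partial chi (Suc n) N + chi (int (Suc N)) / of_nat (Suc N) * multiple_L_partial chi n N"
  by (simp add: prod.nat_ivl_Suc' mult.commute[of "1 + _"] fps_nth_Suc_mult_linear
      flip: fps_nth_prod_linear_eq_multiple_L_partial del: of_nat_Suc)

section \<open>From multiples of q to all N\<close>

text \<open>Vanishing differences carry the limit from the multiples of \<open>q\<close> to each
  shift by \<open>r\<close>; the finitely many \<open>r < q\<close> then share one threshold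
  \<open>M0\<close>.\<close>

lemma tendsto_of_subsequence_mult:
  fixes u :: "nat \<Rightarrow> 'a::real_normed_vector"
  assumes "q > 0" and sub: "(\<lambda>M. u (q * M)) \<longlonglongrightarrow> l"
    and diff: "(\<lambda>N. u (Suc N) - u N) \<longlonglongrightarrow> 0"
  shows "u \<longlonglongrightarrow> l"
proof -
  have top: "filterlim (\<lambda>M. q * M + r) at_top sequentially" for r
    using \<open>q > 0\<close>
    by (intro filterlim_at_top_mono[OF filterlim_ident]) (auto intro!: always_eventually intro: trans_le_add1)
  have r: "(\<lambda>M. u (q * M + r)) \<longlonglongrightarrow> l" for r
  proof (induction r)
    case 0
    then show ?case using sub by simp
  next
    case (Suc r)
    have "(\<lambda>M. u (q * M + r) + (u (Suc (q * M + r)) - u (q * M + r))) \<longlonglongrightarrow> l + 0"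
      by (intro tendsto_add Suc filterlim_compose[OF diff top])
    then show ?case by simp
  qed
  show ?thesis
  proof (rule tendstoI)
    fix e :: real assume "e > 0"
    then have "\<forall>\<^sub>F M in sequentially. \<forall>r\<in>{..<q}. dist (u (q * M + r)) l < e"
      using r by (intro eventually_ball_finite ballI) (auto dest: tendstoD)
    then obtain M0 where M0: "\<And>M r. M \<ge> M0 \<Longrightarrow> r < q \<Longrightarrow> dist (u (q * M + r)) l < e"
      by (auto simp: eventually_sequentially)
    have "dist (u N) l < e" if "N \<ge> q * M0" for N
      using M0[of "N div q" "N mod q"] that \<open>q > 0\<close>
      by (simp add: less_eq_div_iff_mult_less_eq mult.commute)
    then show "\<forall>\<^sub>F N in sequentially. dist (u N) l < e"
      by (auto simp: eventually_sequentially)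
  qed
qed

section \<open>Nonprincipal characters and splitting by residues\<close>

lemma finite_Phi [simp]: "finite (Phi q)"
  by (rule finite_subset[of _ "{..q}"]) (auto simp: Phi_def)

context
  fixes q :: nat and chi :: "int \<Rightarrow> complex"
  assumes chi: "dirichlet_character q chi" and nonprincipal: "\<not> principal_character q chi"
begin

lemma chi_mult: "chi (a * b) = chi a * chi b"
  using chi by (simp add: dirichlet_character_def)

lemma chi_eq_0_iff: "chi a = 0 \<longleftrightarrow> \<not> coprime a (int q)"
  using chi unfolding dirichlet_character_def by blast

lemma chi_add_mult: "chi (a + int q * int m) = chi a"
proof (induction m)
  case (Suc m)
  have "chi (a + int q * int m + int q) = chi (a + int q * int m)"
    using chi by (simp add: dirichlet_character_def)
  then show ?case using Suc by (simp add: algebra_simps)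
qed simp

lemma chi_mod: "chi (int (a mod q)) = chi (int a)"
  using chi_add_mult[of "int (a mod q)" "a div q"] by (simp flip: of_nat_mult of_nat_add)

text \<open>Modulo 1 a character is constantly 1, hence principal.\<close>

lemma q_gt_1: "q > 1"
proof (rule ccontr)
  assume "\<not> q > 1"
  then have q: "q = 1" using chi by (simp add: dirichlet_character_def)
  have "chi 1 * chi 1 = chi 1 * 1" "chi 1 \<noteq> 0"
    using chi_mult[of 1 1] chi_eq_0_iff[of 1] by auto
  then have 1: "chi 1 = 1" by simp
  have "chi a = 1" for a
  proof -
    \<comment> \<open>\<open>chi_add_mult\<close> shifts by natural multiples only, so integers
      below 1 are shifted up to 1 instead.\<close>
    have "chi a = 1" if "a \<ge> 1"
      using chi_add_mult[of 1 "nat (a - 1)"] 1 q that by simp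
    moreover have "chi a = 1" if "a < 1"
      using chi_add_mult[of a "nat (1 - a)"] 1 q that by simp
    ultimately show ?thesis by linarith
  qed
  then show False using chi nonprincipal by (simp add: principal_character_def)
qed

lemma Phi_eq: "Phi q = {j. j < q \<and> coprime j q}"
  using q_gt_1 by (auto simp: Phi_def coprime_iff_gcd_eq_1 Suc_le_eq intro!: gr0I)

text \<open>Multiplication by a unit \<open>a\<close> with \<open>chi a \<noteq> 1\<close> permutes
  the residues, so the sum S satisfies S = chi(a) S. This cancellation later makes the logarithms
  drop out.\<close>

lemma sum_chi_Phi: "(\<Sum>j\<in>Phi q. chi (int j)) = 0"
proof -
  obtain a0 where a0: "coprime a0 (int q)" "chi a0 \<noteq> 1"
    using chi nonprincipal unfolding principal_character_def by blast
  \<comment> \<open>\<open>Phi q\<close> consists of naturals, so the integer witness is replaced by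
    its residue. The sign of the quotient decides which of the two is shifted to the other.\<close>
  define a where "a = nat (a0 mod int q)"
  have a_int: "int a = a0 mod int q" using q_gt_1 by (simp add: a_def)
  have "coprime (int a) (int q)" using a0(1) q_gt_1 unfolding a_int by simp
  then have cop: "coprime a q" by simp
  have "chi (int a) \<noteq> 1"
  proof
    assume 1: "chi (int a) = 1"
    have "chi a0 = chi (int a)"
    proof (cases "a0 div int q \<ge> 0")
      case True
      then show ?thesis using chi_add_mult[of "int a" "nat (a0 div int q)"] by (simp add: a_int)
    next
      case False
      then show ?thesis using chi_add_mult[of a0 "nat (- (a0 div int q))"]
        by (simp add: a_int minus_mult_div_eq_mod)
    qed
    then show False using a0 1 by simp
  qed
  have inj: "inj_on (\<lambda>j. (a * j) mod q) (Phi q)"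
  proof (rule inj_onI)
    fix i j assume ij: "i \<in> Phi q" "j \<in> Phi q" "(a * i) mod q = (a * j) mod q"
    then have "[a * i = a * j] (mod q)" by (simp add: cong_def)
    then have "[i = j] (mod q)" using cop by (simp add: cong_mult_lcancel_nat)
    then show "i = j" using ij by (simp add: Phi_eq cong_def)
  qed
  have "(\<lambda>j. (a * j) mod q) ` Phi q \<subseteq> Phi q"
    using cop q_gt_1 by (auto simp: Phi_eq)
  then have surj: "(\<lambda>j. (a * j) mod q) ` Phi q = Phi q"
    by (intro endo_inj_surj inj) auto
  have "(\<Sum>j\<in>Phi q. chi (int j)) = (\<Sum>j\<in>(\<lambda>j. (a * j) mod q) ` Phi q. chi (int j))"
    by (simp add: surj)
  also have "\<dots> = (\<Sum>j\<in>Phi q. chi (int ((a * j) mod q)))"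
    by (subst sum.reindex[OF inj]) simp
  also have "\<dots> = chi (int a) * (\<Sum>j\<in>Phi q. chi (int j))"
    unfolding chi_mod by (simp add: chi_mult sum_distrib_left)
  finally show ?thesis using \<open>chi (int a) \<noteq> 1\<close> by (metis mult_cancel_right1)
qed

text \<open>For k = q m + j, chi(k) / k = (chi(j) / q) / (j / q + m). Residues not coprime to
  \<open>q\<close> give the factor 1, because \<open>chi\<close> vanishes there.\<close>

lemma prod_linear_split_residues:
  "(\<Prod>k=1..q * M. 1 + fps_const (chi (int k) / of_nat k) * fps_X) =
   (\<Prod>j\<in>Phi q. \<Prod>m<M. 1 + fps_const (chi (int j) / of_nat q / (of_nat j / of_nat q + of_nat m)) * fps_X)"
proof (induction M)
  case (Suc M)
  let ?f = "\<lambda>k. 1 + fps_const (chi (int k) / of_nat k) * fps_X :: complex fps"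
  have disj: "{1..q * M} \<inter> (\<lambda>j. q * M + j) ` {1..q} = {}" by auto
  \<comment> \<open>As \<open>k\<close> starts at 1, a block runs over \<open>j = 1..q\<close>; the
    entry \<open>j = q\<close> drops out later, not being coprime to \<open>q > 1\<close>.\<close>
  have "{1..q * Suc M} = {1..q * M} \<union> (\<lambda>j. q * M + j) ` {1..q}"
  proof (intro equalityI subsetI)
    fix k assume "k \<in> {1..q * Suc M}"
    then show "k \<in> {1..q * M} \<union> (\<lambda>j. q * M + j) ` {1..q}"
      by (cases "k \<le> q * M") (auto intro!: image_eqI[of _ _ "k - q * M"])
  qed auto
  then have "(\<Prod>k=1..q * Suc M. ?f k) = (\<Prod>k=1..q * M. ?f k) * (\<Prod>k\<in>(\<lambda>j. q * M + j) ` {1..q}. ?f k)"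
    by (simp only: prod.union_disjoint[OF finite_atLeastAtMost finite_imageI[OF finite_atLeastAtMost] disj])
  also have "(\<Prod>k\<in>(\<lambda>j. q * M + j) ` {1..q}. ?f k) = (\<Prod>j=1..q. ?f (q * M + j))"
    by (subst prod.reindex) (auto simp: inj_on_def)
  also have "\<dots> = (\<Prod>j\<in>Phi q. 1 + fps_const (chi (int j) / of_nat q / (of_nat j / of_nat q + of_nat M)) * fps_X)"
  proof (rule prod.mono_neutral_cong_right)
    show "Phi q \<subseteq> {1..q}" by (auto simp: Phi_def)
    have per: "chi (int (q * M + j)) = chi (int j)" for j
      using chi_add_mult[of "int j" M] by (simp add: add.commute)
    show "\<forall>j\<in>{1..q} - Phi q. ?f (q * M + j) = 1"
    proof
      fix j assume j: "j \<in> {1..q} - Phi q"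
      then have "\<not> coprime j q" using q_gt_1 by (cases "j = q") (auto simp: Phi_eq)
      then have "chi (int j) = 0" by (simp add: chi_eq_0_iff)
      then show "?f (q * M + j) = 1" by (simp only: per) simp
    qed
    fix j assume "j \<in> Phi q"
    have "chi (int j) / of_nat (q * M + j) = chi (int j) / of_nat q / (of_nat j / of_nat q + of_nat M)"
      using q_gt_1 by (simp add: field_simps)
    then show "?f (q * M + j) = 1 + fps_const (chi (int j) / of_nat q / (of_nat j / of_nat q + of_nat M)) * fps_X"
      by (simp only: per)
  qed simp
  finally show ?case using Suc by (simp add: prod.distrib)
qed simp

lemma norm_chi_bounded: "\<exists>B. \<forall>k. norm (chi (int k)) \<le> B"
proof (intro exI allI)
  fix k
  have "k mod q \<in> {..<q}" using q_gt_1 by simp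
  then have "norm (chi (int (k mod q))) \<le> (\<Sum>j<q. norm (chi (int j)))"
    by (intro member_le_sum) auto
  then show "norm (chi (int k)) \<le> (\<Sum>j<q. norm (chi (int j)))" by (simp only: chi_mod)
qed

lemma chi_over_tendsto_0: "(\<lambda>N. chi (int (Suc N)) / of_nat (Suc N)) \<longlonglongrightarrow> 0"
proof -
  from norm_chi_bounded obtain B where B: "\<forall>k. norm (chi (int k)) \<le> B" ..
  have "(\<lambda>N. B * inverse (real (Suc N))) \<longlonglongrightarrow> B * 0"
    by (rule tendsto_mult_left[OF LIMSEQ_inverse_real_of_nat])
  then have lim: "(\<lambda>N. B * inverse (real (Suc N))) \<longlonglongrightarrow> 0" by simp
  show ?thesis
  proof (rule Lim_null_comparison[OF always_eventually lim], rule allI)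
    fix N
    have "norm (chi (int (Suc N)) / of_nat (Suc N)) = norm (chi (int (Suc N))) / real (Suc N)"
      by (simp only: norm_divide norm_of_nat)
    also have "\<dots> \<le> B / real (Suc N)"
      by (intro divide_right_mono B[rule_format]) auto
    finally show "norm (chi (int (Suc N)) / of_nat (Suc N)) \<le> B * inverse (real (Suc N))"
      by (simp only: divide_inverse)
  qed
qed

section \<open>Convergence of the partial sums and the formula\<close>

text \<open>Along multiples of \<open>q\<close> the limit is computed directly; the induction
  hypothesis serves the passage to all \<open>N\<close>. The quotient
  \<open>chi (int j) / of_nat q\<close> is kept as the parameter \<open>w\<close> of the residue
  factor.\<close>

lemma multiple_L_partial_tendsto:
  "(\<lambda>N. multiple_L_partial chi n N) \<longlonglongrightarrow>
    (\<Sum>k \<in> {k \<in> Phi q \<rightarrow>\<^sub>E (UNIV :: nat set). (\<Sum>j\<in>Phi q. k j) = n}.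
      \<Prod>j\<in>Phi q. if k j = 0 then 1 else (chi (int j) / of_nat q) ^ k j / fact (k j) *
        (\<Sum>m=1..k j. (-1) ^ m *
          partial_Bell (k j) m (\<lambda>i. Polygamma (i - 1) (of_nat j / of_nat q))))"
    (is "_ \<longlonglongrightarrow> ?l n")
proof (induction n)
  case 0
  have "{k \<in> Phi q \<rightarrow>\<^sub>E (UNIV :: nat set). (\<Sum>j\<in>Phi q. k j) = 0} = {\<lambda>j\<in>Phi q. 0}"
    by (auto simp: fun_eq_iff PiE_def extensional_def restrict_def)
  moreover have "{ks :: nat list. length ks = 0 \<and> sorted_wrt (<) ks \<and> set ks \<subseteq> {1..N}} = {[]}" for N
    by auto
  ultimately show ?case by (simp add: multiple_L_partial_def)
next
  case (Suc n)
  let ?w = "\<lambda>j. chi (int j) / of_nat q" and ?y = "\<lambda>j. of_nat j / of_nat q :: complex"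
  let ?F = "\<lambda>j M. \<Prod>m<M. 1 + fps_const (?w j / (?y j + of_nat m)) * fps_X"
  let ?e = "\<lambda>j M. fps_exp (- (?w j * of_real (ln (real M))))"
  have "(\<lambda>M. multiple_L_partial chi (Suc n) (q * M)) \<longlonglongrightarrow> ?l (Suc n)"
  proof -
    \<comment> \<open>The exponents add up to - ln M / q times the sum of \<open>chi\<close> over
      \<open>Phi q\<close>, which is zero.\<close>
    have exp1: "(\<Prod>j\<in>Phi q. ?e j M) = 1" for M
    proof -
      have "(\<Prod>j\<in>A. fps_exp (f j)) = fps_exp (\<Sum>j\<in>A. f j)" if "finite A"
        for A and f :: "nat \<Rightarrow> complex"
        using that by (induction A rule: finite_induct) (auto simp: fps_exp_add_mult)
      then have "(\<Prod>j\<in>Phi q. ?e j M) = fps_exp (\<Sum>j\<in>Phi q. - (?w j * of_real (ln (real M))))"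
        by simp
      also have "(\<Sum>j\<in>Phi q. - (?w j * of_real (ln (real M)))) = 0"
        using sum_chi_Phi by (simp add: sum_negf flip: sum_distrib_right sum_divide_distrib)
      finally show ?thesis by simp
    qed
    have "multiple_L_partial chi (Suc n) (q * M) = fps_nth (\<Prod>j\<in>Phi q. ?F j M * ?e j M) (Suc n)" for M
    proof -
      have "(\<Prod>j\<in>Phi q. ?F j M * ?e j M) = (\<Prod>j\<in>Phi q. ?F j M)"
        by (subst prod.distrib) (simp only: exp1 mult_1_right)
      then show ?thesis
        by (simp only: prod_linear_split_residues[symmetric] fps_nth_prod_linear_eq_multiple_L_partial)
    qed
    then have eq: "multiple_L_partial chi (Suc n) (q * M) =
        (\<Sum>k \<in> {k \<in> Phi q \<rightarrow>\<^sub>E UNIV. (\<Sum>j\<in>Phi q. k j) = Suc n}.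
          \<Prod>j\<in>Phi q. fps_nth (?F j M * ?e j M) (k j))" for M
      by (simp only: fps_nth_prod_PiE[OF finite_Phi])
    show ?thesis
      unfolding eq
    proof (intro tendsto_sum tendsto_prod fps_nth_renormalized_prod_tendsto)
      fix j assume "j \<in> Phi q"
      then show "?y j \<noteq> 0" using q_gt_1 by (auto simp: Phi_def)
    qed
  qed
  moreover have "(\<lambda>N. multiple_L_partial chi (Suc n) (Suc N) - multiple_L_partial chi (Suc n) N) \<longlonglongrightarrow> 0"
  proof -
    \<comment> \<open>The partial sums for \<open>n\<close> converge by the induction hypothesis, so
      multiplying them by a null sequence gives a null sequence.\<close>
    have "(\<lambda>N. chi (int (Suc N)) / of_nat (Suc N) * multiple_L_partial chi n N) \<longlonglongrightarrow> 0 * ?l n"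
      by (intro tendsto_mult chi_over_tendsto_0 Suc)
    then show ?thesis by (simp add: multiple_L_partial_Suc)
  qed
  moreover have "q > 0" using q_gt_1 by simp
  ultimately show ?case
    by (rule tendsto_of_subsequence_mult[rotated])
qed

end

text \<open>The value \<open>lim\<close> says nothing about a divergent sequence, hence convergence
  is claimed as well. The Bell variable with index \<open>i\<close> is \<psi>_(i-1), whence
  \<open>Polygamma (i - 1)\<close>.\<close>

theorem theorem3:
  fixes q n :: nat and chi :: "int \<Rightarrow> complex"
  assumes "primitive_character q chi"
    and "\<not> principal_character q chi"
    and "n \<ge> 1"
  shows "convergent (\<lambda>N. multiple_L_partial chi n N) \<and>
    multiple_L n chi =
      1 / of_nat q ^ n *
      (\<Sum>k \<in> {k \<in> Phi q \<rightarrow>\<^sub>E (UNIV :: nat set). (\<Sum>j\<in>Phi q. k j) = n}.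
         \<Prod>j\<in>Phi q.
           if k j = 0 then 1
           else chi (int j) ^ k j / fact (k j) *
             (\<Sum>m = 1..k j. (-1) ^ m *
                partial_Bell (k j) m (\<lambda>i. Polygamma (i - 1) (of_nat j / of_nat q))))"
proof -
  let ?K = "{k \<in> Phi q \<rightarrow>\<^sub>E (UNIV :: nat set). (\<Sum>j\<in>Phi q. k j) = n}"
  let ?b = "\<lambda>k j. \<Sum>m = 1..k j. (-1) ^ m *
    partial_Bell (k j) m (\<lambda>i. Polygamma (i - 1) (of_nat j / of_nat q))"
  have "dirichlet_character q chi" using assms(1) by (simp add: primitive_character_def)
  note lim = multiple_L_partial_tendsto[OF this assms(2), of n]
  have "(\<Sum>k\<in>?K. \<Prod>j\<in>Phi q. if k j = 0 then 1 else (chi (int j) / of_nat q) ^ k j / fact (k j) * ?b k j) =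
      (\<Sum>k\<in>?K. 1 / of_nat q ^ n *
        (\<Prod>j\<in>Phi q. if k j = 0 then 1 else chi (int j) ^ k j / fact (k j) * ?b k j))"
  proof (intro sum.cong refl)
    \<comment> \<open>Since the \<open>k j\<close> add up to \<open>n\<close>, 1 / q^n distributes
      over the product as the factors 1 / q^(k j); where \<open>k j = 0\<close> such a factor is 1,
      in accordance with the default value.\<close>
    fix k assume "k \<in> ?K"
    then have "1 / of_nat q ^ n = (\<Prod>j\<in>Phi q. 1 / of_nat q ^ k j :: complex)"
      by (simp add: prod_dividef flip: power_sum)
    then have "1 / of_nat q ^ n *
        (\<Prod>j\<in>Phi q. if k j = 0 then 1 else chi (int j) ^ k j / fact (k j) * ?b k j) =
        (\<Prod>j\<in>Phi q. 1 / of_nat q ^ k j * (if k j = 0 then 1 else chi (int j) ^ k j / fact (k j) * ?b k j))"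
      by (simp only: prod.distrib)
    also have "\<dots> = (\<Prod>j\<in>Phi q. if k j = 0 then 1 else (chi (int j) / of_nat q) ^ k j / fact (k j) * ?b k j)"
      by (intro prod.cong refl) (simp add: power_divide mult.commute)
    finally show "(\<Prod>j\<in>Phi q. if k j = 0 then 1 else (chi (int j) / of_nat q) ^ k j / fact (k j) * ?b k j) =
        1 / of_nat q ^ n * (\<Prod>j\<in>Phi q. if k j = 0 then 1 else chi (int j) ^ k j / fact (k j) * ?b k j)"
      by (rule sym)
  qed
  also have "\<dots> = 1 / of_nat q ^ n *
      (\<Sum>k\<in>?K. \<Prod>j\<in>Phi q. if k j = 0 then 1 else chi (int j) ^ k j / fact (k j) * ?b k j)"
    by (rule sum_distrib_left[symmetric])
  finally show ?thesis
    using lim unfolding multiple_L_def by (auto simp: convergent_def dest: limI)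
qed

end
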